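(* Let $\mathcal{A}=\mathcal{A}_1\cup\mathcal{A}_2$ be an arrangement of lines in $\mathbb{P}^3$, with $\mathcal{A}_1,\mathcal{A}_2$ disjoint, $|\mathcal{A}_1|=a$, $|\mathcal{A}_2|=b$, such that every line of $\mathcal{A}_1$ meets every line of $\mathcal{A}_2$ and any two distinct lines in the same $\mathcal{A}_i$ are disjoint (so $\Gamma(\mathcal{A})\cong K_{a,b}$), where $a,b$ are positive integers with $3\le a\le b$ or $a\le b\le 3$. Then there is a smooth quadric surface $Q\subset\mathbb{P}^3$ containing all lines of $\mathcal{A}$; specifically, for each $i=1,2$, the lines of $\mathcal{A}_i$ all lie in one of the two rulings of $Q$.
   Context: A line arrangement is a finite collection of distinct lines in $\mathbb{P}^3$, each defined over the (arbitrary) ground field. A smooth quadric surface $Q\cong\mathbb{P}^1\times\mathbb{P}^1$ has two rulings, i.e. two families of lines on it. *)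

theory Defs
  imports "HOL-Analysis.Analysis"
begin

text \<open>Projective 3-space over a field 'k is modelled by the vector space 'k^4
 (homogeneous coordinates).  A projective line is a 2-dimensional linear
 subspace of 'k^4 (the affine cone over it).  Two lines meet iff their
 cones share a nonzero vector, and are disjoint iff the cones meet only in 0.\<close>

definition is_line :: "('k::field ^ 4) set \<Rightarrow> bool" where
  "is_line L \<longleftrightarrow> (\<exists>u v. (\<forall>a b. a *s u + b *s v = 0 \<longrightarrow> a = 0 \<and> b = 0)
                        \<and> L = {a *s u + b *s v | a b. True})"

definition lines_meet :: "('k::field ^ 4) set \<Rightarrow> ('k ^ 4) set \<Rightarrow> bool" where
  "lines_meet L L' \<longleftrightarrow> (\<exists>x. x \<noteq> 0 \<and> x \<in> L \<and> x \<in> L')"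

definition lines_disjoint :: "('k::field ^ 4) set \<Rightarrow> ('k ^ 4) set \<Rightarrow> bool" where
  "lines_disjoint L L' \<longleftrightarrow> L \<inter> L' = {0}"

text \<open>Smooth quadric surfaces: Q = (segre-quadric) transported by an invertible
 linear change of coordinates M, i.e. Q = {x. segre (M x) = 0} with
 segre y = y1*y4 - y2*y3, the image of P^1 x P^1 under the Segre embedding
 ([s:t],[p:q]) |-> [sp:sq:tp:tq].\<close>

definition segre_form :: "'k::field ^ 4 \<Rightarrow> 'k" where
  "segre_form y = y $ 1 * y $ 4 - y $ 2 * y $ 3"

definition quadric :: "'k::field ^ 4 ^ 4 \<Rightarrow> ('k ^ 4) set" where
  "quadric M = {x. segre_form (M *v x) = 0}"

definition smooth_quadric_matrix :: "'k::field ^ 4 ^ 4 \<Rightarrow> bool" where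
  "smooth_quadric_matrix M \<longleftrightarrow> invertible M"

text \<open>The two rulings of the quadric given by M:
 ruling True  = lines {[sp:sq:tp:tq]} for fixed [p:q] (varying [s:t]),
 ruling False = lines {[ps:pt:qs:qt]} for fixed [p:q] (varying [s:t]).\<close>

definition in_ruling :: "bool \<Rightarrow> 'k::field ^ 4 ^ 4 \<Rightarrow> ('k ^ 4) set \<Rightarrow> bool" where
  "in_ruling r M L \<longleftrightarrow> (\<exists>p q. (p, q) \<noteq> (0, 0) \<and>
      L = {x. \<exists>s t. M *v x = (if r then vector [s * p, s * q, t * p, t * q]
                                    else vector [p * s, p * t, q * s, q * t])})"

end

theory Submission
  imports Defs
begin

(* Three pairwise skew lines can be moved by a projective transformation onto three lines of
   one ruling of the Segre quadric y1 y4 = y2 y3, and a line meeting three pairwise skew lines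
   of one ruling lies in the other ruling: it is spanned by its intersection points with two of
   them, and as its intersection point with the third lies on the quadric, these two points
   share their first factor under the Segre embedding. So if b \<ge> 3, normalising three lines
   of A2 puts every line of A1 into one ruling, and every line of A2 is then one of the three or
   meets three skew lines of A1. If a, b \<le> 2, the intersection points of the lines, completed
   to a basis of k^4, form a frame that can be sent to the coordinate frame, and the coordinate
   lines involved lie on the quadric. *)

lemma vector_4_nth [simp]:
  "(vector [x, y, z, w] :: 'a::zero ^ 4) $ 1 = x"
  "(vector [x, y, z, w] :: 'a::zero ^ 4) $ 2 = y"
  "(vector [x, y, z, w] :: 'a::zero ^ 4) $ 3 = z"
  "(vector [x, y, z, w] :: 'a::zero ^ 4) $ 4 = w"
  unfolding vector_def by simp_all

lemma vec4_eq_iff: "(x :: 'a ^ 4) = y \<longleftrightarrow> x $ 1 = y $ 1 \<and> x $ 2 = y $ 2 \<and> x $ 3 = y $ 3 \<and> x $ 4 = y $ 4"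
  by (simp add: vec_eq_iff forall_4)

section \<open>Spans of two vectors and lines\<close>

definition span2 :: "'k::field ^ 'n \<Rightarrow> 'k ^ 'n \<Rightarrow> ('k ^ 'n) set" where
  "span2 u v = {a *s u + b *s v | a b. True}"

definition indep2 :: "'k::field ^ 'n \<Rightarrow> 'k ^ 'n \<Rightarrow> bool" where
  "indep2 u v \<longleftrightarrow> (\<forall>a b. a *s u + b *s v = 0 \<longrightarrow> a = 0 \<and> b = 0)"

lemma mem_span2: "x \<in> span2 u v \<longleftrightarrow> (\<exists>a b. x = a *s u + b *s v)"
  unfolding span2_def by blast

lemma span2_base: "u \<in> span2 u v" "v \<in> span2 u v"
  unfolding mem_span2
  by (rule exI[of _ 1], rule exI[of _ 0], simp) (rule exI[of _ 0], rule exI[of _ 1], simp)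

lemma span2_lincomb:
  assumes "x \<in> span2 u v" "y \<in> span2 u v"
  shows "c *s x + d *s y \<in> span2 u v"
proof -
  obtain a b a' b' where "x = a *s u + b *s v" "y = a' *s u + b' *s v"
    using assms unfolding mem_span2 by blast
  then have "c *s x + d *s y = (c * a + d * a') *s u + (c * b + d * b') *s v"
    by (simp add: vec_eq_iff algebra_simps)
  then show ?thesis unfolding mem_span2 by blast
qed

lemma span2_smult: "x \<in> span2 u v \<Longrightarrow> c *s x \<in> span2 u v"
  using span2_lincomb[of x u v x c 0] by simp

lemma span2_subset: "u \<in> span2 x y \<Longrightarrow> v \<in> span2 x y \<Longrightarrow> span2 u v \<subseteq> span2 x y"
  unfolding span2_def[of u v] by (auto intro: span2_lincomb)

lemma indep2_nonzero:
  assumes "indep2 x y"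
  shows "x \<noteq> 0" "y \<noteq> 0"
  using assms[unfolded indep2_def, rule_format, of 1 0] assms[unfolded indep2_def, rule_format, of 0 1]
  by auto

lemma span2_eq_if_indep2:
  assumes "indep2 u v" "x \<in> span2 u v" "y \<in> span2 u v" "indep2 x y"
  shows "span2 x y = span2 u v"
proof
  show "span2 x y \<subseteq> span2 u v" using assms(2,3) by (rule span2_subset)
  obtain a b c d where x: "x = a *s u + b *s v" and y: "y = c *s u + d *s v"
    using assms(2,3) unfolding mem_span2 by blast
  define D where "D = a * d - b * c"
  have u: "d *s x + (- b) *s y = D *s u" and v: "(- c) *s x + a *s y = D *s v"
    unfolding x y D_def by (simp_all add: vec_eq_iff algebra_simps)
  have "D \<noteq> 0"
  proof
    assume "D = 0"
    then have "d *s x + (- b) *s y = 0" "(- c) *s x + a *s y = 0" using u v by simp_all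
    then have "d = 0 \<and> - b = 0" "- c = 0 \<and> a = 0" using assms(4) unfolding indep2_def by blast+
    then have "d = 0 \<and> b = 0 \<and> c = 0 \<and> a = 0" by simp
    with x indep2_nonzero(1)[OF assms(4)] show False by simp
  qed
  have "D *s u \<in> span2 x y" "D *s v \<in> span2 x y"
    unfolding u[symmetric] v[symmetric] by (rule span2_lincomb[OF span2_base])+
  then have "(1 / D) *s (D *s u) \<in> span2 x y" "(1 / D) *s (D *s v) \<in> span2 x y"
    by (simp_all only: span2_smult)
  with \<open>D \<noteq> 0\<close> show "span2 u v \<subseteq> span2 x y"
    by (intro span2_subset) (simp_all add: vector_smult_assoc)
qed

lemma is_line_iff_span2: "is_line L \<longleftrightarrow> (\<exists>u v. indep2 u v \<and> L = span2 u v)"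
  unfolding is_line_def indep2_def span2_def by blast

lemma line_lincomb: "is_line L \<Longrightarrow> x \<in> L \<Longrightarrow> y \<in> L \<Longrightarrow> a *s x + b *s y \<in> L"
  unfolding is_line_iff_span2 by (auto intro: span2_lincomb)

lemma line_smult: "is_line L \<Longrightarrow> x \<in> L \<Longrightarrow> a *s x \<in> L"
  using line_lincomb[of L x x a 0] by simp

lemma line_eq_span2:
  assumes "is_line L" "x \<in> L" "y \<in> L" "indep2 x y"
  shows "L = span2 x y"
proof -
  obtain u v where uv: "indep2 u v" "L = span2 u v" using assms(1) unfolding is_line_iff_span2 by blast
  with assms(2-4) have "span2 x y = span2 u v" by (intro span2_eq_if_indep2) simp_all
  with uv(2) show ?thesis by simp
qed

lemma line_through_point:
  assumes "is_line L" "x \<in> L" "x \<noteq> 0"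
  obtains y where "indep2 x y" "L = span2 x y"
proof -
  obtain u v where uv: "indep2 u v" "L = span2 u v" using assms(1) unfolding is_line_iff_span2 by blast
  obtain a b where x: "x = a *s u + b *s v" using assms(2) uv(2) by (auto simp: mem_span2)
  have "indep2 x v" if "a \<noteq> 0"
    unfolding indep2_def
  proof (intro allI impI)
    fix c d assume "c *s x + d *s v = 0"
    then have "(c * a) *s u + (c * b + d) *s v = 0" unfolding x by (simp add: vec_eq_iff algebra_simps)
    then have "c * a = 0" "c * b + d = 0" using uv(1) unfolding indep2_def by blast+
    with \<open>a \<noteq> 0\<close> show "c = 0 \<and> d = 0" by simp
  qed
  moreover have "indep2 x u" if "a = 0"
    unfolding indep2_def
  proof (intro allI impI)
    fix c d assume "c *s x + d *s u = 0"
    then have "d *s u + (c * b) *s v = 0" unfolding x using \<open>a = 0\<close> by (simp add: vec_eq_iff algebra_simps)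
    then have "d = 0" "c * b = 0" using uv(1) unfolding indep2_def by blast+
    moreover have "b \<noteq> 0" using x assms(3) \<open>a = 0\<close> by auto
    ultimately show "c = 0 \<and> d = 0" by simp
  qed
  moreover have "u \<in> L" "v \<in> L" using uv(2) span2_base by blast+
  ultimately show ?thesis
    using that line_eq_span2[OF assms(1,2)] by (cases "a = 0") blast+
qed

lemma indep2_if_disjoint:
  assumes "is_line L" "is_line L'" "lines_disjoint L L'" "x \<in> L" "y \<in> L'" "x \<noteq> 0" "y \<noteq> 0"
  shows "indep2 x y"
  unfolding indep2_def
proof (intro allI impI)
  fix a b assume ab: "a *s x + b *s y = 0"
  then have "a *s x = - (b *s y)" by (simp only: eq_neg_iff_add_eq_0)
  then have "a *s x = (- b) *s y" by (simp add: vec_eq_iff)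
  then have "a *s x \<in> L'" using line_smult[OF assms(2,5)] by metis
  with line_smult[OF assms(1,4)] have "a *s x = 0" using assms(3) unfolding lines_disjoint_def by blast
  with ab assms(6,7) show "a = 0 \<and> b = 0" by simp
qed

section \<open>Frames and linear images of lines\<close>

definition indep4 :: "'k::field ^ 'n \<Rightarrow> 'k ^ 'n \<Rightarrow> 'k ^ 'n \<Rightarrow> 'k ^ 'n \<Rightarrow> bool" where
  "indep4 e1 e2 e3 e4 \<longleftrightarrow> (\<forall>c1 c2 c3 c4. c1 *s e1 + c2 *s e2 + c3 *s e3 + c4 *s e4 = 0
      \<longrightarrow> c1 = 0 \<and> c2 = 0 \<and> c3 = 0 \<and> c4 = 0)"

lemma indep4_if_disjoint:
  assumes "is_line L" "is_line L'" "lines_disjoint L L'"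
    and "x \<in> L" "y \<in> L" "indep2 x y" "x' \<in> L'" "y' \<in> L'" "indep2 x' y'"
  shows "indep4 x y x' y'"
  unfolding indep4_def
proof (intro allI impI)
  fix c1 c2 c3 c4 assume h: "c1 *s x + c2 *s y + c3 *s x' + c4 *s y' = 0"
  have "c1 *s x + c2 *s y - ((- c3) *s x' + (- c4) *s y') = c1 *s x + c2 *s y + c3 *s x' + c4 *s y'"
    by (simp add: vec_eq_iff algebra_simps)
  then have e: "c1 *s x + c2 *s y = (- c3) *s x' + (- c4) *s y'" using h by simp
  have "c1 *s x + c2 *s y \<in> L" by (rule line_lincomb[OF assms(1,4,5)])
  moreover have "c1 *s x + c2 *s y \<in> L'" unfolding e by (rule line_lincomb[OF assms(2,7,8)])
  ultimately have "c1 *s x + c2 *s y = 0" using assms(3) unfolding lines_disjoint_def by blast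
  with e have "c1 *s x + c2 *s y = 0" "(- c3) *s x' + (- c4) *s y' = 0" by simp_all
  then have "c1 = 0 \<and> c2 = 0" "- c3 = 0 \<and> - c4 = 0" using assms(6,9) unfolding indep2_def by blast+
  then show "c1 = 0 \<and> c2 = 0 \<and> c3 = 0 \<and> c4 = 0" by simp
qed

lemma indep4_extend:
  fixes x y z :: "'k::field ^ 4"
  assumes "\<forall>c1 c2 c3. c1 *s x + c2 *s y + c3 *s z = 0 \<longrightarrow> c1 = 0 \<and> c2 = 0 \<and> c3 = 0"
  obtains w where "indep4 x y z w"
proof -
  have "\<not> UNIV \<subseteq> vec.span {x, y, z}"
  proof
    assume "UNIV \<subseteq> vec.span {x, y, z}"
    then have "vec.dim (UNIV :: ('k ^ 4) set) \<le> card {x, y, z}" by (intro vec.dim_le_card) auto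
    also have "\<dots> \<le> 3" by (simp add: card_insert_if)
    finally have "vec.dim (UNIV :: ('k ^ 4) set) \<le> 3" .
    moreover have "vec.dim (UNIV :: ('k ^ 4) set) = CARD(4)" by (rule vec_dim_card)
    ultimately show False by simp
  qed
  then obtain w where w: "w \<notin> vec.span {x, y, z}" by blast
  have "indep4 x y z w"
    unfolding indep4_def
  proof (intro allI impI)
    fix c1 c2 c3 c4 assume h: "c1 *s x + c2 *s y + c3 *s z + c4 *s w = 0"
    have "c4 = 0"
    proof (rule ccontr)
      assume "c4 \<noteq> 0"
      have "c4 *s w = - (c1 *s x + c2 *s y + c3 *s z)"
        using h by (simp only: eq_neg_iff_add_eq_0 add.commute)
      then have "w = (- c1 / c4) *s x + (- c2 / c4) *s y + (- c3 / c4) *s z"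
        using \<open>c4 \<noteq> 0\<close> by (simp add: vec4_eq_iff field_simps)
      moreover have "(- c1 / c4) *s x + (- c2 / c4) *s y + (- c3 / c4) *s z \<in> vec.span {x, y, z}"
        by (intro vec.span_add vec.span_scale vec.span_base) auto
      ultimately show False using w by simp
    qed
    then show "c1 = 0 \<and> c2 = 0 \<and> c3 = 0 \<and> c4 = 0" using h assms by simp
  qed
  then show ?thesis by (rule that)
qed

lemma frame_coordinates:
  fixes e1 e2 e3 e4 :: "'k::field ^ 4"
  assumes "indep4 e1 e2 e3 e4"
  obtains M :: "'k ^ 4 ^ 4" where "invertible M"
    "\<And>c1 c2 c3 c4. M *v (c1 *s e1 + c2 *s e2 + c3 *s e3 + c4 *s e4) = vector [c1, c2, c3, c4]"
proof -
  define P :: "'k ^ 4 ^ 4" where "P = (\<chi> i j. (if j = 1 then e1 else if j = 2 then e2 else if j = 3 then e3 else e4) $ i)"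
  have P: "P *v c = c $ 1 *s e1 + c $ 2 *s e2 + c $ 3 *s e3 + c $ 4 *s e4" for c
    by (simp add: vec4_eq_iff matrix_vector_mult_def P_def sum_4 algebra_simps)
  have "c = 0" if "P *v c = 0" for c
  proof -
    have "c $ 1 = 0 \<and> c $ 2 = 0 \<and> c $ 3 = 0 \<and> c $ 4 = 0" using assms that P unfolding indep4_def by metis
    then show ?thesis by (simp add: vec4_eq_iff)
  qed
  then have "invertible P" by (simp add: invertible_left_inverse matrix_left_invertible_ker)
  then obtain M where PM: "P ** M = mat 1" and MP: "M ** P = mat 1" unfolding invertible_def by blast
  have "invertible M" unfolding invertible_def using PM MP by blast
  moreover have "M *v (c1 *s e1 + c2 *s e2 + c3 *s e3 + c4 *s e4) = vector [c1, c2, c3, c4]" for c1 c2 c3 c4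
  proof -
    have "M *v (c1 *s e1 + c2 *s e2 + c3 *s e3 + c4 *s e4) = (M ** P) *v vector [c1, c2, c3, c4]"
      by (simp add: P flip: matrix_vector_mul_assoc)
    then show ?thesis using MP by simp
  qed
  ultimately show ?thesis by (rule that)
qed

lemma indep4_spanning:
  fixes e1 e2 e3 e4 :: "'k::field ^ 4"
  assumes "indep4 e1 e2 e3 e4"
  obtains c1 c2 c3 c4 where "x = c1 *s e1 + c2 *s e2 + c3 *s e3 + c4 *s e4"
proof -
  obtain M :: "'k ^ 4 ^ 4" where M: "invertible M"
    "\<And>c1 c2 c3 c4. M *v (c1 *s e1 + c2 *s e2 + c3 *s e3 + c4 *s e4) = vector [c1, c2, c3, c4]"
    using frame_coordinates[OF assms] by blast
  let ?y = "M *v x"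
  have "M *v (?y $ 1 *s e1 + ?y $ 2 *s e2 + ?y $ 3 *s e3 + ?y $ 4 *s e4) = M *v x"
    unfolding M(2) by (simp add: vec4_eq_iff)
  then have "?y $ 1 *s e1 + ?y $ 2 *s e2 + ?y $ 3 *s e3 + ?y $ 4 *s e4 = x"
    by (rule injD[OF inj_matrix_vector_mult[OF M(1)]])
  then show ?thesis by (rule that[OF sym])
qed

lemma image_span2: "(*v) (A :: 'k::field ^ 'n ^ 'm) ` span2 u v = span2 (A *v u) (A *v v)"
proof
  show "(*v) A ` span2 u v \<subseteq> span2 (A *v u) (A *v v)"
    by (fastforce simp: mem_span2 matrix_vector_right_distrib vector_scalar_commute)
  show "span2 (A *v u) (A *v v) \<subseteq> (*v) A ` span2 u v"
  proof
    fix y assume "y \<in> span2 (A *v u) (A *v v)"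
    then obtain a b where "y = A *v (a *s u + b *s v)"
      by (auto simp: mem_span2 matrix_vector_right_distrib vector_scalar_commute)
    moreover have "a *s u + b *s v \<in> span2 u v" by (auto simp: mem_span2)
    ultimately show "y \<in> (*v) A ` span2 u v" by blast
  qed
qed

lemma indep2_image:
  assumes "invertible (A :: 'k::field ^ 'n ^ 'n)" "indep2 u v"
  shows "indep2 (A *v u) (A *v v)"
  unfolding indep2_def
proof (intro allI impI)
  fix a b assume "a *s (A *v u) + b *s (A *v v) = 0"
  then have "A *v (a *s u + b *s v) = A *v 0"
    by (simp add: matrix_vector_right_distrib vector_scalar_commute)
  then have "a *s u + b *s v = 0" using inj_matrix_vector_mult[OF assms(1)] by (meson injD)
  then show "a = 0 \<and> b = 0" using assms(2) unfolding indep2_def by blast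
qed

lemma is_line_image:
  assumes "invertible (A :: 'k::field ^ 4 ^ 4)" "is_line L"
  shows "is_line ((*v) A ` L)"
proof -
  obtain u v where "indep2 u v" "L = span2 u v" using assms(2) unfolding is_line_iff_span2 by blast
  then show ?thesis unfolding is_line_iff_span2 using image_span2 indep2_image[OF assms(1)] by blast
qed

lemma lines_meet_image:
  assumes "invertible (A :: 'k::field ^ 4 ^ 4)" "lines_meet L L'"
  shows "lines_meet ((*v) A ` L) ((*v) A ` L')"
proof -
  obtain x where "x \<noteq> 0" "x \<in> L" "x \<in> L'" using assms(2) unfolding lines_meet_def by blast
  moreover have "A *v x \<noteq> 0" using \<open>x \<noteq> 0\<close> inj_matrix_vector_mult[OF assms(1)]
    by (metis injD matrix_vector_mult_0_right)
  ultimately show ?thesis unfolding lines_meet_def by blast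
qed

lemma lines_disjoint_image:
  "invertible (A :: 'k::field ^ 4 ^ 4) \<Longrightarrow> lines_disjoint L L' \<Longrightarrow> lines_disjoint ((*v) A ` L) ((*v) A ` L')"
  unfolding lines_disjoint_def by (simp add: image_Int[symmetric] inj_matrix_vector_mult)

lemma lines_meet_commute: "lines_meet L L' \<longleftrightarrow> lines_meet L' L"
  unfolding lines_meet_def by blast

lemma lines_disjoint_sym: "lines_disjoint L L' \<Longrightarrow> lines_disjoint L' L"
  unfolding lines_disjoint_def by blast

section \<open>The rulings of the Segre quadric\<close>

definition segre_line :: "bool \<Rightarrow> 'k::field \<Rightarrow> 'k \<Rightarrow> ('k ^ 4) set" where
  "segre_line r p q = {y. \<exists>s t. y = (if r then vector [s * p, s * q, t * p, t * q]
                                       else vector [p * s, p * t, q * s, q * t])}"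

lemma segre_line_True:
  fixes p q :: "'k::field"
  shows "segre_line True p q = span2 (vector [p, q, 0, 0]) (vector [0, 0, p, q])"
proof -
  have "(vector [s * p, s * q, t * p, t * q] :: 'k ^ 4) = s *s vector [p, q, 0, 0] + t *s vector [0, 0, p, q]"
    for s t :: 'k
    by (simp add: vec4_eq_iff)
  then show ?thesis unfolding segre_line_def span2_def by simp
qed

lemma segre_line_False:
  fixes p q :: "'k::field"
  shows "segre_line False p q = span2 (vector [p, 0, q, 0]) (vector [0, p, 0, q])"
proof -
  have "(vector [p * s, p * t, q * s, q * t] :: 'k ^ 4) = s *s vector [p, 0, q, 0] + t *s vector [0, p, 0, q]"
    for s t :: 'k
    by (simp add: vec4_eq_iff mult.commute)
  then show ?thesis unfolding segre_line_def span2_def by simp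
qed

lemma mem_segre_line_True: "x \<in> segre_line True p q \<longleftrightarrow> (\<exists>s t. x = vector [s * p, s * q, t * p, t * q])"
  unfolding segre_line_def by simp

lemma segre_line_is_line:
  fixes p q :: "'k::field"
  assumes "(p, q) \<noteq> (0, 0)"
  shows "is_line (segre_line r p q)"
proof -
  have "indep2 (vector [p, q, 0, 0] :: 'k ^ 4) (vector [0, 0, p, q])"
    "indep2 (vector [p, 0, q, 0] :: 'k ^ 4) (vector [0, p, 0, q])"
    using assms unfolding indep2_def by (auto simp: vec4_eq_iff)
  then show ?thesis
    by (cases r) (auto simp: is_line_iff_span2 segre_line_True segre_line_False)
qed

lemma segre_form_segre_line: "x \<in> segre_line r p q \<Longrightarrow> segre_form x = 0"
  unfolding segre_line_def segre_form_def by (cases r) (auto simp: algebra_simps)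

lemma in_ruling_iff_image:
  assumes "invertible M"
  shows "in_ruling r M L \<longleftrightarrow> (\<exists>p q. (p, q) \<noteq> (0, 0) \<and> (*v) M ` L = segre_line r p q)"
proof -
  have "inj ((*v) M)" by (rule inj_matrix_vector_mult[OF assms])
  moreover have "surj ((*v) M)"
    using assms matrix_right_invertible_surjective unfolding invertible_def by blast
  ultimately have image: "L = (*v) M -` S \<longleftrightarrow> (*v) M ` L = S" for S
    by (metis inj_vimage_image_eq surj_image_vimage_eq)
  have "in_ruling r M L \<longleftrightarrow> (\<exists>p q. (p, q) \<noteq> (0, 0) \<and> L = (*v) M -` segre_line r p q)"
    unfolding in_ruling_def segre_line_def vimage_def mem_Collect_eq ..
  then show ?thesis by (simp only: image)
qed

lemma in_ruling_if_image:
  "invertible M \<Longrightarrow> (*v) M ` L = segre_line r p q \<Longrightarrow> (p, q) \<noteq> (0, 0) \<Longrightarrow> in_ruling r M L"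
  using in_ruling_iff_image by blast

lemma in_ruling_subset_quadric: "in_ruling r M L \<Longrightarrow> L \<subseteq> quadric M"
  unfolding in_ruling_def quadric_def segre_form_def by (cases r) (auto simp: algebra_simps)

lemma frame_in_rulings:
  assumes "indep4 e1 e2 e3 e4"
  obtains M :: "'k::field ^ 4 ^ 4" where "invertible M"
    "in_ruling False M (span2 e1 e2)" "in_ruling False M (span2 e3 e4)"
    "in_ruling False M (span2 (e1 + e3) (e2 + e4))"
    "in_ruling True M (span2 e1 e3)" "in_ruling True M (span2 e2 e4)"
proof -
  obtain M :: "'k ^ 4 ^ 4" where M: "invertible M"
    "\<And>c1 c2 c3 c4. M *v (c1 *s e1 + c2 *s e2 + c3 *s e3 + c4 *s e4) = vector [c1, c2, c3, c4]"
    using frame_coordinates[OF assms] by blast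
  have "M *v e1 = vector [1, 0, 0, 0]" "M *v e2 = vector [0, 1, 0, 0]"
    "M *v e3 = vector [0, 0, 1, 0]" "M *v e4 = vector [0, 0, 0, 1]"
    "M *v (e1 + e3) = vector [1, 0, 1, 0]" "M *v (e2 + e4) = vector [0, 1, 0, 1]"
    using M(2)[of 1 0 0 0] M(2)[of 0 1 0 0] M(2)[of 0 0 1 0] M(2)[of 0 0 0 1]
      M(2)[of 1 0 1 0] M(2)[of 0 1 0 1] by simp_all
  then have "(*v) M ` span2 e1 e2 = segre_line False 1 0" "(*v) M ` span2 e3 e4 = segre_line False 0 1"
    "(*v) M ` span2 (e1 + e3) (e2 + e4) = segre_line False 1 1"
    "(*v) M ` span2 e1 e3 = segre_line True 1 0" "(*v) M ` span2 e2 e4 = segre_line True 0 1"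
    by (simp_all add: image_span2 segre_line_True segre_line_False)
  note images = this
  have "in_ruling False M (span2 e1 e2)" by (rule in_ruling_if_image[OF M(1) images(1)]) simp
  moreover have "in_ruling False M (span2 e3 e4)" by (rule in_ruling_if_image[OF M(1) images(2)]) simp
  moreover have "in_ruling False M (span2 (e1 + e3) (e2 + e4))"
    by (rule in_ruling_if_image[OF M(1) images(3)]) simp
  moreover have "in_ruling True M (span2 e1 e3)" by (rule in_ruling_if_image[OF M(1) images(4)]) simp
  moreover have "in_ruling True M (span2 e2 e4)" by (rule in_ruling_if_image[OF M(1) images(5)]) simp
  ultimately show ?thesis using that M(1) by blast
qed

definition swap23 :: "'k::field ^ 4 ^ 4" where
  "swap23 = vector [vector [1, 0, 0, 0], vector [0, 0, 1, 0], vector [0, 1, 0, 0], vector [0, 0, 0, 1]]"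

lemma swap23_apply: "swap23 *v x = vector [x $ 1, x $ 3, x $ 2, x $ 4]"
  by (simp add: vec4_eq_iff swap23_def matrix_vector_mult_def sum_4)

lemma swap23_swap23 [simp]: "swap23 *v (swap23 *v x) = x"
  by (simp add: swap23_apply vec4_eq_iff)

lemma invertible_swap23: "invertible swap23"
  unfolding invertible_left_inverse matrix_left_invertible_ker
  by (metis swap23_swap23 matrix_vector_mult_0_right)

lemma swap23_eq_iff: "swap23 *v x = y \<longleftrightarrow> x = swap23 *v y"
  by (metis swap23_swap23)

lemma swap23_segre_line: "(*v) swap23 ` segre_line r p q = segre_line (\<not> r) p q"
proof -
  have point: "swap23 *v (if r then vector [s * p, s * q, t * p, t * q] else vector [p * s, p * t, q * s, q * t])
      = (if \<not> r then vector [s * p, s * q, t * p, t * q] else vector [p * s, p * t, q * s, q * t])" for s t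
    by (cases r) (simp_all add: swap23_apply vec4_eq_iff mult.commute)
  have mem: "swap23 *v y \<in> segre_line r p q \<longleftrightarrow> y \<in> segre_line (\<not> r) p q" for y
    unfolding segre_line_def mem_Collect_eq swap23_eq_iff point ..
  show ?thesis
  proof (intro set_eqI iffI)
    fix y assume "y \<in> (*v) swap23 ` segre_line r p q"
    then obtain x where "x \<in> segre_line r p q" "y = swap23 *v x" by blast
    then show "y \<in> segre_line (\<not> r) p q" using mem[of y] by simp
  next
    fix y assume "y \<in> segre_line (\<not> r) p q"
    then have "swap23 *v y \<in> segre_line r p q" using mem by blast
    then show "y \<in> (*v) swap23 ` segre_line r p q" by (metis image_eqI swap23_swap23)
  qed
qed

lemma in_ruling_swap23:
  assumes "invertible M" "in_ruling r M L"
  shows "in_ruling (\<not> r) (swap23 ** M) L"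
proof -
  obtain p q where pq: "(p, q) \<noteq> (0, 0)" "(*v) M ` L = segre_line r p q"
    using assms(2) unfolding in_ruling_iff_image[OF assms(1)] by blast
  have "(*v) (swap23 ** M) ` L = (*v) swap23 ` (*v) M ` L"
    by (simp add: image_image matrix_vector_mul_assoc)
  also have "\<dots> = segre_line (\<not> r) p q" by (simp add: pq(2) swap23_segre_line)
  finally show ?thesis
    using in_ruling_if_image[OF invertible_mult[OF invertible_swap23 assms(1)]] pq(1) by blast
qed

lemma swap23_mult_swap23: "swap23 ** (swap23 ** M) = M"
  unfolding matrix_eq by (simp flip: matrix_vector_mul_assoc)

section \<open>Transversals of three lines of a ruling\<close>

lemma proportional_pair:
  fixes p q p' q' :: "'k::field"
  assumes "(p, q) \<noteq> (0, 0)" "p * q' = q * p'"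
  obtains c where "p' = c * p" "q' = c * q"
proof (cases "p = 0")
  case True
  then have "q \<noteq> 0" "p' = 0" using assms by auto
  with True show ?thesis by (intro that[of "q' / q"]) simp_all
next
  case False
  with assms(2) show ?thesis by (intro that[of "p' / p"]) (simp_all add: field_simps)
qed

lemma segre_line_params_if_disjoint:
  fixes p1 q1 p2 q2 :: "'k::field"
  assumes "lines_disjoint (segre_line True p1 q1) (segre_line True p2 q2)"
    and "(p1, q1) \<noteq> (0, 0)" "(p2, q2) \<noteq> (0, 0)"
  shows "p1 * q2 \<noteq> q1 * p2"
proof
  assume "p1 * q2 = q1 * p2"
  then have "p2 * q1 = q2 * p1" by (simp add: mult.commute)
  then obtain c where c: "p1 = c * p2" "q1 = c * q2" using proportional_pair[OF assms(3)] by blast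
  let ?x = "vector [p1, q1, 0, 0] :: 'k ^ 4"
  have "?x \<in> segre_line True p1 q1"
    unfolding mem_segre_line_True by (rule exI[of _ 1], rule exI[of _ 0]) simp
  moreover have "?x \<in> segre_line True p2 q2"
    unfolding mem_segre_line_True c by (rule exI[of _ c], rule exI[of _ 0]) simp
  moreover have "?x \<noteq> 0" using assms(2) by (simp add: vec4_eq_iff)
  ultimately show False using assms(1) unfolding lines_disjoint_def by blast
qed

lemma segre_form_lincomb:
  fixes a b s1 t1 p1 q1 s2 t2 p2 q2 :: "'k::field"
  shows "segre_form (a *s vector [s1 * p1, s1 * q1, t1 * p1, t1 * q1]
                      + b *s vector [s2 * p2, s2 * q2, t2 * p2, t2 * q2])
    = a * b * (s1 * t2 - t1 * s2) * (p1 * q2 - q1 * p2)"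
  unfolding segre_form_def by simp algebra

lemma lincomb_coeffs_nonzero_if_disjoint:
  assumes "is_line L1" "is_line L2" "u1 \<in> L1" "u2 \<in> L2"
    and "u3 \<in> L3" "u3 \<noteq> 0" "lines_disjoint L1 L3" "lines_disjoint L2 L3"
    and "u3 = a *s u1 + b *s u2"
  shows "a \<noteq> 0" "b \<noteq> 0"
proof -
  show "a \<noteq> 0"
  proof
    assume "a = 0"
    then have "u3 \<in> L2" using assms(9) line_smult[OF assms(2,4)] by simp
    then show False using assms(5,6,8) unfolding lines_disjoint_def by blast
  qed
  show "b \<noteq> 0"
  proof
    assume "b = 0"
    then have "u3 \<in> L1" using assms(9) line_smult[OF assms(1,3)] by simp
    then show False using assms(5,6,7) unfolding lines_disjoint_def by blast
  qed
qed

lemma segre_points_in_segre_line_False: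
  fixes s1 t1 s2 t2 :: "'k::field"
  assumes "(s1, t1) \<noteq> (0, 0)" "s1 * t2 = t1 * s2"
  shows "vector [s1 * p1, s1 * q1, t1 * p1, t1 * q1] \<in> segre_line False s1 t1"
    "vector [s2 * p2, s2 * q2, t2 * p2, t2 * q2] \<in> segre_line False s1 t1"
proof -
  show "vector [s1 * p1, s1 * q1, t1 * p1, t1 * q1] \<in> segre_line False s1 t1"
    unfolding segre_line_def by auto
  obtain c where "s2 = c * s1" "t2 = c * t1" using proportional_pair assms by blast
  then have "vector [s2 * p2, s2 * q2, t2 * p2, t2 * q2]
      = vector [s1 * (c * p2), s1 * (c * q2), t1 * (c * p2), t1 * (c * q2)]"
    by (simp add: ac_simps)
  then show "vector [s2 * p2, s2 * q2, t2 * p2, t2 * q2] \<in> segre_line False s1 t1"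
    unfolding segre_line_def by auto
qed

lemma transversal_of_True_segre_lines:
  fixes N :: "('k::field ^ 4) set"
  assumes N: "is_line N"
    and nonzero: "(p1, q1) \<noteq> (0, 0)" "(p2, q2) \<noteq> (0, 0)"
    and meet: "lines_meet N (segre_line True p1 q1)" "lines_meet N (segre_line True p2 q2)"
      "lines_meet N (segre_line True p3 q3)"
    and disj: "lines_disjoint (segre_line True p1 q1) (segre_line True p2 q2)"
      "lines_disjoint (segre_line True p1 q1) (segre_line True p3 q3)"
      "lines_disjoint (segre_line True p2 q2) (segre_line True p3 q3)"
  obtains s t where "(s, t) \<noteq> (0, 0)" "N = segre_line False s t"
proof -
  obtain u1 u2 u3 where u: "u1 \<noteq> 0" "u1 \<in> N" "u1 \<in> segre_line True p1 q1"
    "u2 \<noteq> 0" "u2 \<in> N" "u2 \<in> segre_line True p2 q2"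
    "u3 \<noteq> 0" "u3 \<in> N" "u3 \<in> segre_line True p3 q3"
    using meet unfolding lines_meet_def by blast
  obtain s1 t1 s2 t2 where u1: "u1 = vector [s1 * p1, s1 * q1, t1 * p1, t1 * q1]"
    and u2: "u2 = vector [s2 * p2, s2 * q2, t2 * p2, t2 * q2]"
    using u(3,6) unfolding mem_segre_line_True by blast
  have lines: "is_line (segre_line True p1 q1)" "is_line (segre_line True p2 q2)"
    using nonzero by (simp_all add: segre_line_is_line)
  have indep: "indep2 u1 u2" by (rule indep2_if_disjoint[OF lines disj(1) u(3,6,1,4)])
  then have N_eq: "N = span2 u1 u2" by (rule line_eq_span2[OF N u(2,5)])
  obtain a b where u3: "u3 = a *s u1 + b *s u2" using u(8) unfolding N_eq mem_span2 by blast
  txt \<open>Since u3 lies on the quadric, the factorisation of the Segre form forces [s1:t1] = [s2:t2].\<close>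
  have "a * b * (s1 * t2 - t1 * s2) * (p1 * q2 - q1 * p2) = 0"
    using segre_form_segre_line[OF u(9)] unfolding u3 u1 u2 segre_form_lincomb .
  moreover have "a \<noteq> 0" "b \<noteq> 0"
    using lincomb_coeffs_nonzero_if_disjoint[OF lines u(3,6,9,7) disj(2,3) u3] by blast+
  moreover have "p1 * q2 \<noteq> q1 * p2" by (rule segre_line_params_if_disjoint[OF disj(1) nonzero])
  ultimately have st_eq: "s1 * t2 = t1 * s2" by simp
  have st: "(s1, t1) \<noteq> (0, 0)" using u(1) unfolding u1 by (auto simp: vec4_eq_iff)
  have "u1 \<in> segre_line False s1 t1" "u2 \<in> segre_line False s1 t1"
    unfolding u1 u2 by (rule segre_points_in_segre_line_False[OF st st_eq])+
  then have "segre_line False s1 t1 = span2 u1 u2"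
    using line_eq_span2[OF segre_line_is_line[OF st] _ _ indep] by blast
  then show ?thesis using that st N_eq by simp
qed

lemma transversal_in_ruling_True:
  assumes M: "invertible M" and L: "is_line L"
    and ruling: "in_ruling True M N1" "in_ruling True M N2" "in_ruling True M N3"
    and disj: "lines_disjoint N1 N2" "lines_disjoint N1 N3" "lines_disjoint N2 N3"
    and meet: "lines_meet L N1" "lines_meet L N2" "lines_meet L N3"
  shows "in_ruling False M L"
proof -
  obtain p1 q1 where N1: "(p1, q1) \<noteq> (0, 0)" "(*v) M ` N1 = segre_line True p1 q1"
    using ruling(1) unfolding in_ruling_iff_image[OF M] by blast
  obtain p2 q2 where N2: "(p2, q2) \<noteq> (0, 0)" "(*v) M ` N2 = segre_line True p2 q2"
    using ruling(2) unfolding in_ruling_iff_image[OF M] by blast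
  obtain p3 q3 where N3: "(*v) M ` N3 = segre_line True p3 q3"
    using ruling(3) unfolding in_ruling_iff_image[OF M] by blast
  obtain s t where "(s, t) \<noteq> (0, 0)" "(*v) M ` L = segre_line False s t"
  proof (rule transversal_of_True_segre_lines[OF is_line_image[OF M L] N1(1) N2(1)])
    show "lines_meet ((*v) M ` L) (segre_line True p1 q1)"
      "lines_meet ((*v) M ` L) (segre_line True p2 q2)"
      "lines_meet ((*v) M ` L) (segre_line True p3 q3)"
      unfolding N1(2)[symmetric] N2(2)[symmetric] N3[symmetric]
      using meet by (simp_all add: lines_meet_image[OF M])
    show "lines_disjoint (segre_line True p1 q1) (segre_line True p2 q2)"
      "lines_disjoint (segre_line True p1 q1) (segre_line True p3 q3)"
      "lines_disjoint (segre_line True p2 q2) (segre_line True p3 q3)"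
      unfolding N1(2)[symmetric] N2(2)[symmetric] N3[symmetric]
      using disj by (simp_all add: lines_disjoint_image[OF M])
  qed
  then show ?thesis using in_ruling_if_image[OF M] by blast
qed

lemma transversal_in_ruling:
  assumes M: "invertible M" and L: "is_line L"
    and ruling: "in_ruling r M N1" "in_ruling r M N2" "in_ruling r M N3"
    and disj: "lines_disjoint N1 N2" "lines_disjoint N1 N3" "lines_disjoint N2 N3"
    and meet: "lines_meet L N1" "lines_meet L N2" "lines_meet L N3"
  shows "in_ruling (\<not> r) M L"
proof (cases r)
  case True
  with assms show ?thesis using transversal_in_ruling_True by simp
next
  case False
  have M': "invertible (swap23 ** M)" by (rule invertible_mult[OF invertible_swap23 M])
  have "in_ruling True (swap23 ** M) N" if "in_ruling r M N" for N
    using in_ruling_swap23[OF M that] False by simp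
  with ruling have "in_ruling False (swap23 ** M) L"
    using transversal_in_ruling_True[OF M' L _ _ _ disj meet] by blast
  with False show ?thesis
    using in_ruling_swap23[OF M'] by (fastforce simp: swap23_mult_swap23)
qed

section \<open>Normal forms of small configurations\<close>

lemma indep2_projection_along_skew_line:
  assumes "is_line K" "is_line K'" "lines_disjoint K K'"
    and "w1 \<in> K" "w2 \<in> K" "indep2 w1 w2" "z1 \<in> K'" "z2 \<in> K'"
    and "w1 = x1 + z1" "w2 = x2 + z2"
  shows "indep2 x1 x2"
  unfolding indep2_def
proof (intro allI impI)
  fix a b assume ab: "a *s x1 + b *s x2 = 0"
  have "a *s w1 + b *s w2 = a *s x1 + b *s x2 + (a *s z1 + b *s z2)"
    unfolding assms(9,10) by (simp add: vec_eq_iff algebra_simps)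
  with ab have eq: "a *s w1 + b *s w2 = a *s z1 + b *s z2" by simp
  have "a *s w1 + b *s w2 \<in> K" by (rule line_lincomb[OF assms(1,4,5)])
  moreover have "a *s w1 + b *s w2 \<in> K'" unfolding eq by (rule line_lincomb[OF assms(2,7,8)])
  ultimately have "a *s w1 + b *s w2 = 0" using assms(3) unfolding lines_disjoint_def by blast
  then show "a = 0 \<and> b = 0" using assms(6) unfolding indep2_def by blast
qed

lemma skew_lines_direct_sum:
  assumes "is_line K1" "is_line K2" "lines_disjoint K1 K2"
  obtains x z where "x \<in> K1" "z \<in> K2" "w = x + z"
proof -
  obtain u1 u2 where u: "indep2 u1 u2" "K1 = span2 u1 u2" using assms(1) unfolding is_line_iff_span2 by blast
  obtain v1 v2 where v: "indep2 v1 v2" "K2 = span2 v1 v2" using assms(2) unfolding is_line_iff_span2 by blast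
  have mem: "u1 \<in> K1" "u2 \<in> K1" "v1 \<in> K2" "v2 \<in> K2" using u(2) v(2) span2_base by blast+
  have "indep4 u1 u2 v1 v2" by (rule indep4_if_disjoint[OF assms mem(1,2) u(1) mem(3,4) v(1)])
  then obtain c1 c2 c3 c4 where "w = c1 *s u1 + c2 *s u2 + c3 *s v1 + c4 *s v2"
    by (rule indep4_spanning)
  then have "w = (c1 *s u1 + c2 *s u2) + (c3 *s v1 + c4 *s v2)" by (simp add: add.assoc)
  moreover have "c1 *s u1 + c2 *s u2 \<in> K1" "c3 *s v1 + c4 *s v2 \<in> K2"
    using line_lincomb[OF assms(1) mem(1,2)] line_lincomb[OF assms(2) mem(3,4)] by blast+
  ultimately show ?thesis using that by blast
qed

lemma three_skew_lines_in_ruling: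
  assumes lines: "is_line K1" "is_line K2" "is_line K3"
    and disj: "lines_disjoint K1 K2" "lines_disjoint K1 K3" "lines_disjoint K2 K3"
  obtains M where "invertible M" "in_ruling False M K1" "in_ruling False M K2" "in_ruling False M K3"
proof -
  txt \<open>The components of a basis of K3 in the direct sum of K1 and K2 form a frame
    in which K3 becomes the graph of an isomorphism from K1 to K2.\<close>
  obtain w1 w2 where w: "indep2 w1 w2" "K3 = span2 w1 w2" using lines(3) unfolding is_line_iff_span2 by blast
  have mem: "w1 \<in> K3" "w2 \<in> K3" using w(2) span2_base by blast+
  obtain x1 z1 where w1: "x1 \<in> K1" "z1 \<in> K2" "w1 = x1 + z1"
    by (rule skew_lines_direct_sum[OF lines(1,2) disj(1)])
  obtain x2 z2 where w2: "x2 \<in> K1" "z2 \<in> K2" "w2 = x2 + z2"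
    by (rule skew_lines_direct_sum[OF lines(1,2) disj(1)])
  have w': "w1 = z1 + x1" "w2 = z2 + x2" using w1(3) w2(3) by (simp_all add: add.commute)
  have x: "indep2 x1 x2" by (rule indep2_projection_along_skew_line
      [OF lines(3,2) lines_disjoint_sym[OF disj(3)] mem w(1) w1(2) w2(2) w1(3) w2(3)])
  have z: "indep2 z1 z2" by (rule indep2_projection_along_skew_line
      [OF lines(3,1) lines_disjoint_sym[OF disj(2)] mem w(1) w1(1) w2(1) w'])
  have "indep4 x1 x2 z1 z2" by (rule indep4_if_disjoint[OF lines(1,2) disj(1) w1(1) w2(1) x w1(2) w2(2) z])
  then obtain M where M: "invertible M" "in_ruling False M (span2 x1 x2)" "in_ruling False M (span2 z1 z2)"
    "in_ruling False M (span2 (x1 + z1) (x2 + z2))"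
    using frame_in_rulings by blast
  have "K1 = span2 x1 x2" by (rule line_eq_span2[OF lines(1) w1(1) w2(1) x])
  moreover have "K2 = span2 z1 z2" by (rule line_eq_span2[OF lines(2) w1(2) w2(2) z])
  moreover have "K3 = span2 (x1 + z1) (x2 + z2)" using w(2) w1(3) w2(3) by simp
  ultimately show ?thesis using M by (intro that) simp_all
qed

lemma meeting_lines_in_rulings:
  assumes "is_line L" "is_line N" "lines_meet L N" "L \<noteq> N"
  obtains M where "invertible M" "in_ruling False M L" "in_ruling True M N"
proof -
  obtain x where x: "x \<noteq> 0" "x \<in> L" "x \<in> N" using assms(3) unfolding lines_meet_def by blast
  obtain y where y: "indep2 x y" "L = span2 x y" using line_through_point[OF assms(1) x(2,1)] by blast
  obtain z where z: "indep2 x z" "N = span2 x z" using line_through_point[OF assms(2) x(3,1)] by blast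
  have "y \<in> L" using y(2) span2_base by blast
  have "\<forall>c1 c2 c3. c1 *s x + c2 *s y + c3 *s z = 0 \<longrightarrow> c1 = 0 \<and> c2 = 0 \<and> c3 = 0"
  proof (intro allI impI)
    fix c1 c2 c3 assume h: "c1 *s x + c2 *s y + c3 *s z = 0"
    have "c3 = 0"
    proof (rule ccontr)
      assume "c3 \<noteq> 0"
      have "c3 *s z - ((- c1) *s x + (- c2) *s y) = c1 *s x + c2 *s y + c3 *s z"
        by (simp add: vec_eq_iff algebra_simps)
      with h have z_eq: "c3 *s z = (- c1) *s x + (- c2) *s y" by simp
      have "c3 *s z \<in> L" unfolding z_eq by (rule line_lincomb[OF assms(1) x(2) \<open>y \<in> L\<close>])
      then have "(1 / c3) *s (c3 *s z) \<in> L" by (rule line_smult[OF assms(1)])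
      with \<open>c3 \<noteq> 0\<close> have "z \<in> L" by (simp add: vector_smult_assoc)
      then have "L = N" unfolding z(2) by (rule line_eq_span2[OF assms(1) x(2) _ z(1)])
      with assms(4) show False ..
    qed
    with h y(1) show "c1 = 0 \<and> c2 = 0 \<and> c3 = 0" unfolding indep2_def by simp
  qed
  then obtain w where "indep4 x y z w" by (rule indep4_extend)
  then obtain M where "invertible M" "in_ruling False M (span2 x y)" "in_ruling True M (span2 x z)"
    using frame_in_rulings by blast
  with y(2) z(2) show ?thesis by (intro that) simp_all
qed

lemma line_meeting_skew_lines_in_rulings:
  assumes "is_line L" "is_line N1" "is_line N2" "lines_disjoint N1 N2"
    and "lines_meet L N1" "lines_meet L N2"
  obtains M where "invertible M" "in_ruling True M L" "in_ruling False M N1" "in_ruling False M N2"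
proof -
  obtain x1 where x1: "x1 \<noteq> 0" "x1 \<in> L" "x1 \<in> N1" using assms(5) unfolding lines_meet_def by blast
  obtain x3 where x3: "x3 \<noteq> 0" "x3 \<in> L" "x3 \<in> N2" using assms(6) unfolding lines_meet_def by blast
  obtain x2 where x2: "indep2 x1 x2" "N1 = span2 x1 x2" using line_through_point[OF assms(2) x1(3,1)] by blast
  obtain x4 where x4: "indep2 x3 x4" "N2 = span2 x3 x4" using line_through_point[OF assms(3) x3(3,1)] by blast
  have "x2 \<in> N1" "x4 \<in> N2" using x2(2) x4(2) span2_base by blast+
  then have "indep4 x1 x2 x3 x4" by (intro indep4_if_disjoint[OF assms(2-4) x1(3) _ x2(1) x3(3) _ x4(1)])
  then obtain M where M: "invertible M" "in_ruling True M (span2 x1 x3)"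
    "in_ruling False M (span2 x1 x2)" "in_ruling False M (span2 x3 x4)"
    using frame_in_rulings by blast
  have "L = span2 x1 x3"
    by (rule line_eq_span2[OF assms(1) x1(2) x3(2) indep2_if_disjoint[OF assms(2-4) x1(3) x3(3) x1(1) x3(1)]])
  with x2(2) x4(2) M show ?thesis by (intro that) simp_all
qed

lemma skew_quadrilateral_in_rulings:
  assumes lines: "is_line L1" "is_line L2" "is_line N1" "is_line N2"
    and disj: "lines_disjoint L1 L2" "lines_disjoint N1 N2"
    and meet: "lines_meet L1 N1" "lines_meet L1 N2" "lines_meet L2 N1" "lines_meet L2 N2"
  obtains M where "invertible M" "in_ruling False M L1" "in_ruling False M L2"
    "in_ruling True M N1" "in_ruling True M N2"
proof -
  obtain x11 where x11: "x11 \<noteq> 0" "x11 \<in> L1" "x11 \<in> N1" using meet(1) unfolding lines_meet_def by blast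
  obtain x12 where x12: "x12 \<noteq> 0" "x12 \<in> L1" "x12 \<in> N2" using meet(2) unfolding lines_meet_def by blast
  obtain x21 where x21: "x21 \<noteq> 0" "x21 \<in> L2" "x21 \<in> N1" using meet(3) unfolding lines_meet_def by blast
  obtain x22 where x22: "x22 \<noteq> 0" "x22 \<in> L2" "x22 \<in> N2" using meet(4) unfolding lines_meet_def by blast
  have L1: "indep2 x11 x12" by (rule indep2_if_disjoint[OF lines(3,4) disj(2) x11(3) x12(3) x11(1) x12(1)])
  have L2: "indep2 x21 x22" by (rule indep2_if_disjoint[OF lines(3,4) disj(2) x21(3) x22(3) x21(1) x22(1)])
  have N1: "indep2 x11 x21" by (rule indep2_if_disjoint[OF lines(1,2) disj(1) x11(2) x21(2) x11(1) x21(1)])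
  have N2: "indep2 x12 x22" by (rule indep2_if_disjoint[OF lines(1,2) disj(1) x12(2) x22(2) x12(1) x22(1)])
  have "indep4 x11 x12 x21 x22"
    by (rule indep4_if_disjoint[OF lines(1,2) disj(1) x11(2) x12(2) L1 x21(2) x22(2) L2])
  then obtain M where M: "invertible M" "in_ruling False M (span2 x11 x12)" "in_ruling False M (span2 x21 x22)"
    "in_ruling True M (span2 x11 x21)" "in_ruling True M (span2 x12 x22)"
    using frame_in_rulings by blast
  have "L1 = span2 x11 x12" by (rule line_eq_span2[OF lines(1) x11(2) x12(2) L1])
  moreover have "L2 = span2 x21 x22" by (rule line_eq_span2[OF lines(2) x21(2) x22(2) L2])
  moreover have "N1 = span2 x11 x21" by (rule line_eq_span2[OF lines(3) x11(3) x21(3) N1])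
  moreover have "N2 = span2 x12 x22" by (rule line_eq_span2[OF lines(4) x12(3) x22(3) N2])
  ultimately show ?thesis using M by (intro that) simp_all
qed

section \<open>Bipartite arrangements\<close>

lemma three_distinct_elements:
  assumes "3 \<le> card A"
  obtains x y z where "x \<in> A" "y \<in> A" "z \<in> A" "x \<noteq> y" "x \<noteq> z" "y \<noteq> z"
proof -
  obtain B where "B \<subseteq> A" "card B = 3" using obtain_subset_with_card_n[OF assms] by blast
  then obtain x y z where "{x, y, z} \<subseteq> A" "x \<noteq> y" "x \<noteq> z" "y \<noteq> z" unfolding card_3_iff by auto
  then show ?thesis using that by blast
qed

lemma arrangement_in_rulings_of_three_skew:
  assumes lines: "\<forall>L \<in> A1 \<union> A2. is_line L"
    and meet: "\<forall>L \<in> A1. \<forall>N \<in> A2. lines_meet L N"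
    and skew1: "pairwise lines_disjoint A1" and skew2: "pairwise lines_disjoint A2"
    and card: "3 \<le> card A2" "3 \<le> card A1 \<or> card A2 = 3"
  obtains M where "invertible M" "\<forall>L \<in> A1. in_ruling True M L" "\<forall>N \<in> A2. in_ruling False M N"
proof -
  obtain K1 K2 K3 where K: "K1 \<in> A2" "K2 \<in> A2" "K3 \<in> A2" "K1 \<noteq> K2" "K1 \<noteq> K3" "K2 \<noteq> K3"
    using card(1) by (rule three_distinct_elements)
  have K_disj: "lines_disjoint K1 K2" "lines_disjoint K1 K3" "lines_disjoint K2 K3"
    using skew2 K unfolding pairwise_def by blast+
  have "is_line K1" "is_line K2" "is_line K3" using lines K(1-3) by blast+
  then obtain M where M: "invertible M" and K_ruling: "in_ruling False M K1" "in_ruling False M K2" "in_ruling False M K3"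
    using K_disj by (rule three_skew_lines_in_ruling)
  have A1: "in_ruling True M L" if "L \<in> A1" for L
    using transversal_in_ruling[OF M(1) _ K_ruling K_disj] lines meet K(1-3) that by simp
  have "in_ruling False M N" if N: "N \<in> A2" for N
    using card(2)
  proof
    assume "3 \<le> card A1"
    then obtain L1 L2 L3 where L: "L1 \<in> A1" "L2 \<in> A1" "L3 \<in> A1" "L1 \<noteq> L2" "L1 \<noteq> L3" "L2 \<noteq> L3"
      by (rule three_distinct_elements)
    have "lines_disjoint L1 L2" "lines_disjoint L1 L3" "lines_disjoint L2 L3"
      using skew1 L unfolding pairwise_def by blast+
    moreover have "lines_meet N L1" "lines_meet N L2" "lines_meet N L3"
      using meet L(1-3) N lines_meet_commute by blast+
    ultimately show ?thesis
      using transversal_in_ruling[OF M(1) _ A1[OF L(1)] A1[OF L(2)] A1[OF L(3)]] lines N by simp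
  next
    assume "card A2 = 3"
    then have "A2 = {K1, K2, K3}"
      using K by (intro card_subset_eq[symmetric]) (auto intro: card_ge_0_finite simp: card_insert_if)
    with N K_ruling show ?thesis by auto
  qed
  with M(1) A1 show ?thesis by (intro that) blast+
qed

lemma small_arrangement_in_rulings:
  assumes lines: "\<forall>L \<in> A1 \<union> A2. is_line L" and "A1 \<inter> A2 = {}"
    and meet: "\<forall>L \<in> A1. \<forall>N \<in> A2. lines_meet L N"
    and skew1: "pairwise lines_disjoint A1" and skew2: "pairwise lines_disjoint A2"
    and card: "1 \<le> card A1" "card A1 \<le> card A2" "card A2 \<le> 2"
  obtains M r1 r2 where "invertible M" "\<forall>L \<in> A1. in_ruling r1 M L" "\<forall>N \<in> A2. in_ruling r2 M N"
proof -
  consider "card A1 = 1" "card A2 = 1" | "card A1 = 1" "card A2 = 2" | "card A1 = 2" "card A2 = 2"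
    using card by linarith
  then show ?thesis
  proof cases
    case 1
    then obtain L N where A: "A1 = {L}" "A2 = {N}" by (meson card_1_singletonE)
    with assms(2) have "L \<noteq> N" by auto
    have "is_line L" "is_line N" "lines_meet L N" using lines meet A by auto
    then obtain M where "invertible M" "in_ruling False M L" "in_ruling True M N"
      using \<open>L \<noteq> N\<close> by (rule meeting_lines_in_rulings)
    then show ?thesis using that A by blast
  next
    case 2
    then obtain L N1 N2 where A: "A1 = {L}" "A2 = {N1, N2}" "N1 \<noteq> N2"
      by (metis card_1_singletonE card_2_iff)
    then have "is_line L" "is_line N1" "is_line N2" "lines_disjoint N1 N2" "lines_meet L N1" "lines_meet L N2"
      using lines meet skew2 unfolding pairwise_def by auto
    then obtain M where "invertible M" "in_ruling True M L" "in_ruling False M N1" "in_ruling False M N2"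
      by (rule line_meeting_skew_lines_in_rulings)
    then show ?thesis using that A by blast
  next
    case 3
    then obtain L1 L2 N1 N2 where A: "A1 = {L1, L2}" "L1 \<noteq> L2" "A2 = {N1, N2}" "N1 \<noteq> N2"
      by (meson card_2_iff)
    then have "is_line L1" "is_line L2" "is_line N1" "is_line N2"
      "lines_disjoint L1 L2" "lines_disjoint N1 N2"
      "lines_meet L1 N1" "lines_meet L1 N2" "lines_meet L2 N1" "lines_meet L2 N2"
      using lines meet skew1 skew2 unfolding pairwise_def by auto
    then obtain M where "invertible M" "in_ruling False M L1" "in_ruling False M L2"
      "in_ruling True M N1" "in_ruling True M N2"
      by (rule skew_quadrilateral_in_rulings)
    then show ?thesis using that A by blast
  qed
qed

theorem lemma2p3:
  fixes A1 A2 :: "('k::field ^ 4) set set" and a b :: nat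
  assumes "finite A1" and "finite A2"
    and "\<forall>L \<in> A1 \<union> A2. is_line L"
    and "A1 \<inter> A2 = {}"
    and "card A1 = a" and "card A2 = b"
    and "\<forall>L \<in> A1. \<forall>L' \<in> A2. lines_meet L L'"
    and "\<forall>L \<in> A1. \<forall>L' \<in> A1. L \<noteq> L' \<longrightarrow> lines_disjoint L L'"
    and "\<forall>L \<in> A2. \<forall>L' \<in> A2. L \<noteq> L' \<longrightarrow> lines_disjoint L L'"
    and "a \<ge> 1" and "b \<ge> 1"
    and "(3 \<le> a \<and> a \<le> b) \<or> (a \<le> b \<and> b \<le> 3)"
  shows "\<exists>M. smooth_quadric_matrix M
           \<and> (\<forall>L \<in> A1 \<union> A2. L \<subseteq> quadric M)
           \<and> (\<exists>r1. \<forall>L \<in> A1. in_ruling r1 M L)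
           \<and> (\<exists>r2. \<forall>L \<in> A2. in_ruling r2 M L)"
proof -
  have skew: "pairwise lines_disjoint A1" "pairwise lines_disjoint A2"
    using assms(8,9) unfolding pairwise_def by blast+
  obtain M r1 r2 where M: "invertible M" "\<forall>L \<in> A1. in_ruling r1 M L" "\<forall>L \<in> A2. in_ruling r2 M L"
  proof (cases "3 \<le> b")
    case True
    with assms(5,6,12) have "3 \<le> card A2" "3 \<le> card A1 \<or> card A2 = 3" by auto
    then obtain M where "invertible M" "\<forall>L \<in> A1. in_ruling True M L" "\<forall>L \<in> A2. in_ruling False M L"
      by (rule arrangement_in_rulings_of_three_skew[OF assms(3,7) skew])
    then show ?thesis by (rule that)
  next
    case False
    with assms(5,6,10,12) have "1 \<le> card A1" "card A1 \<le> card A2" "card A2 \<le> 2" by auto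
    then show ?thesis using that by (rule small_arrangement_in_rulings[OF assms(3,4,7) skew])
  qed
  then show ?thesis unfolding smooth_quadric_matrix_def using in_ruling_subset_quadric by blast
qed



end
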